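(* Let $d\ge 1$ and suppose that a set $X\subseteq\mathbb{T}_{\pm}^d$ is TO-convex. Then the closure $\mathrm{cl}(X)$ is equal to the intersection of the closed tropical halfspaces that contain it. Furthermore, if $X$ is a nonempty TO-convex cone, then $\mathrm{cl}(X)$ is equal to the intersection of the linear closed tropical halfspaces that contain it.
   Context: Signed tropical numbers. Let $\mathbb{O}=-\infty$ be the tropical zero. $\mathbb{T}_{>\mathbb{O}}=\mathbb{R}$ (positive numbers), $\mathbb{T}_{<\mathbb{O}}=\{\ominus r: r\in\mathbb{R}\}$ (negative numbers), $\mathbb{T}_{\ge\mathbb{O}}=\mathbb{R}\cup\{\mathbb{O}\}$, $\mathbb{T}_{\pm}=\mathbb{T}_{>\mathbb{O}}\cup\mathbb{T}_{<\mathbb{O}}\cup\{\mathbb{O}\}$, balanced numbers $\mathbb{T}_{\bullet}=\{\bullet r: r\in\mathbb{R}\}\cup\{\mathbb{O}\}$, symmetrized semiring $\mathbb{S}=\mathbb{T}_{\pm}\cup\mathbb{T}_{\bullet}$. The norm is $|r|=|\ominus r|=|\bullet r|=r$ and $|\mathbb{O}|=\mathbb{O}$; the sign $\mathrm{tsgn}$ takes values in $\{\oplus,\ominus,\bullet,\mathbb{O}\}$. Addition on $\mathbb{S}$: $x\oplus y$ equals $x$ if $|x|>|y|$, $y$ if $|y|>|x|$, $x$ if $|x|=|y|$ and $\mathrm{tsgn}(x)=\mathrm{tsgn}(y)$, and $\bullet|x|$ if $|x|=|y|$ and the signs differ. Multiplication: $x\odot y$ has norm $|x|+|y|$ and sign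 the product of signs (with $\oplus,\ominus,\bullet$ multiplying like $1,-1,0$); $\mathbb{O}$ is absorbing. The multiplicative unit is the real number $0$. Operations extend to vectors and matrices in the usual way. Order on $\mathbb{T}_{\pm}$: $x>y$ iff $x\oplus(\ominus y)\in\mathbb{T}_{>\mathbb{O}}$ (a total order). $\mathbb{T}_{\pm}$ carries the order topology and $\mathbb{T}_{\pm}^d$ the product topology; $\mathrm{cl}$ denotes closure. Closed tropical halfspaces. For $a=(a_0,\dots,a_d)\in\mathbb{T}_{\pm}^{d+1}$ with $(a_1,\dots,a_d)\ne(\mathbb{O},\dots,\mathbb{O})$, $\overline{\mathcal{H}}^+(a)=\{x\in\mathbb{T}_{\pm}^d: a_0\oplus a_1\odot x_1\oplus\dots\oplus a_d\odot x_d\in\mathbb{T}_{>\mathbb{O}}\cup\mathbb{T}_{\bullet}\}$; it is linear if $a_0=\mathbb{O}$. An empty intersection of halfspaces is $\mathbb{T}_{\pm}^d$. A set $X\subseteq\mathbb{T}_{\pm}^d$ is a cone if $\lambda\odot X\subseteq X$ for all $\lambda\in\mathbb{T}_{>\mathbb{O}}$. TO-convexity. For $s\in\mathbb{S}$, $\mathcal{U}(s)=\{x\in\mathbb{T}_{\pm}:\ominus|s|\le x\le|s|\}$ if $s\in\mathbb{T}_{\bullet}$ and $\mathcal{U}(s)=\{s\}$ otherwise; for vectors $\mathcal{U}(s)=\prod_i\mathcal{U}(s_i)$. For a finite set $T=\{v_1,\dots,v_n\}\subseteq\mathbb{T}_{\pm}^d$, $\mathrm{conv}_{TO}(T)=\bigcup\{\mathcal{U}(\lambda_1\odot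 v_1\oplus\dots\oplus\lambda_n\odot v_n):\lambda_i\in\mathbb{T}_{\ge\mathbb{O}},\ \bigoplus_i\lambda_i=0\}$. A set $M\subseteq\mathbb{T}_{\pm}^d$ is TO-convex if $\mathrm{conv}_{TO}(T)\subseteq M$ for all finite $T\subseteq M$. *)

theory Defs
  imports "HOL-Analysis.Analysis"
begin

section \<open>The symmetrized tropical semiring\<close>

datatype tsign = Plus | Minus | Balanced

instantiation tsign :: times
begin

fun times_tsign :: "tsign \<Rightarrow> tsign \<Rightarrow> tsign" where
  "Plus * t = t"
| "Minus * Plus = Minus"
| "Minus * Minus = Plus"
| "Minus * Balanced = Balanced"
| "Balanced * t = Balanced"

instance ..

end

text \<open>
  \<open>TZero\<close> is the tropical zero, of norm minus infinity; \<open>Elem Plus r\<close>,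
  \<open>Elem Minus r\<close> and \<open>Elem Balanced r\<close> are the positive, negative and balanced
  element of norm \<open>r\<close>.  The fourth value of the sign map is the constructor \<open>TZero\<close>.
  Tropical addition, multiplication and sign change are written \<open>+\<close>, \<open>*\<close>
  and unary \<open>-\<close>; hence \<open>0\<close> is the tropical zero and \<open>1\<close> is the real number
  zero.  Note that \<open>x + (- x)\<close> is balanced, but nonzero unless \<open>x = 0\<close>.
\<close>

datatype symtrop = TZero | Elem tsign real

instantiation symtrop :: "{zero, one, plus, times, uminus}"
begin

definition zero_symtrop :: symtrop where "0 = TZero"

definition one_symtrop :: symtrop where "1 = Elem Plus 0"

fun plus_symtrop :: "symtrop \<Rightarrow> symtrop \<Rightarrow> symtrop" where
  "TZero + y = y"
| "Elem s a + TZero = Elem s a"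
| "Elem s a + Elem t b =
    (if a > b then Elem s a else if b > a then Elem t b
     else if s = t then Elem s a else Elem Balanced a)"

fun times_symtrop :: "symtrop \<Rightarrow> symtrop \<Rightarrow> symtrop" where
  "TZero * y = TZero"
| "Elem s a * TZero = TZero"
| "Elem s a * Elem t b = Elem (s * t) (a + b)"

fun uminus_symtrop :: "symtrop \<Rightarrow> symtrop" where
  "- TZero = TZero"
| "- Elem s a = Elem (Minus * s) a"

instance ..

end

lemma tsign_mult_assoc: "(s * t) * u = s * (t * u)" for s t u :: tsign
  by (cases s; cases t; cases u) simp_all

lemma tsign_mult_commute: "s * t = t * s" for s t :: tsign
  by (cases s; cases t) simp_all

instance symtrop :: comm_semiring_1
proof
  fix x y z :: symtrop
  show "x + y + z = x + (y + z)"
    by (cases x; cases y; cases z) auto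
  show "x + y = y + x"
    by (cases x; cases y) auto
  show "0 + x = x"
    by (simp add: zero_symtrop_def)
  show "x * y * z = x * (y * z)"
    by (cases x; cases y; cases z) (simp_all add: tsign_mult_assoc)
  show "x * y = y * x"
    by (cases x; cases y) (simp_all add: tsign_mult_commute)
  show "1 * x = x"
    by (cases x) (simp_all add: one_symtrop_def)
  show "0 * x = 0" "x * 0 = 0"
    by (cases x; simp add: zero_symtrop_def)+
  show "(x + y) * z = x * z + y * z"
  proof (cases x; cases y; cases z)
    fix s a t b u c
    assume "x = Elem s a" "y = Elem t b" "z = Elem u c"
    then show ?thesis
      by (cases s; cases t; cases u) simp_all
  qed simp_all
  show "(0 :: symtrop) \<noteq> 1"
    by (simp add: zero_symtrop_def one_symtrop_def)
qed

definition tpos :: "symtrop set" where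
  "tpos = range (Elem Plus)"

definition tneg :: "symtrop set" where
  "tneg = range (Elem Minus)"

definition tnonneg :: "symtrop set" where
  "tnonneg = tpos \<union> {0}"

definition tbal :: "symtrop set" where
  "tbal = range (Elem Balanced) \<union> {0}"


section \<open>Signed tropical numbers\<close>

text \<open>
  The signed numbers form a type of their own, so that they can carry the order topology
  and the library's vectors over them the product topology; \<open>to_sym\<close> is the inclusion into
  the symmetrized semiring.
\<close>

typedef strop = "tpos \<union> tneg \<union> {0}"
  morphisms to_sym Abs_strop
  by blast

setup_lifting type_definition_strop

instantiation strop :: "{zero, one, times, uminus}"
begin

lift_definition zero_strop :: strop is 0
  by simp

lift_definition one_strop :: strop is 1
  by (simp add: tpos_def one_symtrop_def)

lift_definition times_strop :: "strop \<Rightarrow> strop \<Rightarrow> strop" is "(*)"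
  by (auto simp: tpos_def tneg_def zero_symtrop_def)

lift_definition uminus_strop :: "strop \<Rightarrow> strop" is uminus
  by (auto simp: tpos_def tneg_def zero_symtrop_def)

instance ..

end

text \<open>The norm, with values in the nonnegative signed numbers.\<close>

lift_definition tnorm :: "symtrop \<Rightarrow> strop"
  is "\<lambda>x. case x of TZero \<Rightarrow> TZero | Elem s r \<Rightarrow> Elem Plus r"
  by (auto simp: tpos_def zero_symtrop_def split: symtrop.splits)

instantiation strop :: linorder
begin

definition less_strop :: "strop \<Rightarrow> strop \<Rightarrow> bool" where
  "y < x \<longleftrightarrow> to_sym x + (- to_sym y) \<in> tpos"

definition less_eq_strop :: "strop \<Rightarrow> strop \<Rightarrow> bool" where
  "y \<le> x \<longleftrightarrow> y < x \<or> y = x" for x y :: strop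

lemma strop_less_trans: "x < z" if "x < y" "y < z" for x y z :: strop
  using that to_sym[of x] to_sym[of y] to_sym[of z]
  by (auto simp: less_strop_def tpos_def tneg_def zero_symtrop_def split: if_splits)

lemma strop_less_asym: "\<not> y < x" if "x < y" for x y :: strop
  using that to_sym[of x] to_sym[of y]
  by (auto simp: less_strop_def tpos_def tneg_def zero_symtrop_def split: if_splits)

lemma strop_less_total: "x < y \<or> x = y \<or> y < x" for x y :: strop
proof -
  have pos: "Elem s r \<in> tpos \<longleftrightarrow> s = Plus" for s r
    by (auto simp: tpos_def)
  have cases: "to_sym z \<in> insert TZero (range (Elem Plus) \<union> range (Elem Minus))" for z
    using to_sym[of z] by (auto simp: tpos_def tneg_def zero_symtrop_def)
  show ?thesis
    using cases[of x] cases[of y] unfolding to_sym_inject[symmetric] less_strop_def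
    by (auto simp: pos split: if_splits)
qed

instance
proof
  fix x y z :: strop
  show "x < y \<longleftrightarrow> x \<le> y \<and> \<not> y \<le> x"
    by (metis less_eq_strop_def strop_less_asym)
  show "x \<le> x"
    by (simp add: less_eq_strop_def)
  show "x \<le> y \<Longrightarrow> y \<le> z \<Longrightarrow> x \<le> z"
    unfolding less_eq_strop_def using strop_less_trans by blast
  show "x \<le> y \<Longrightarrow> y \<le> x \<Longrightarrow> x = y"
    unfolding less_eq_strop_def using strop_less_asym by blast
  show "x \<le> y \<or> y \<le> x"
    using strop_less_total by (auto simp: less_eq_strop_def)
qed

end

instantiation strop :: linorder_topology
begin

definition open_strop :: "strop set \<Rightarrow> bool" where
  "open_strop = generate_topology (range (\<lambda>a. {..<a}) \<union> range (\<lambda>a. {a<..}))"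

instance
  by standard (simp add: open_strop_def)

end

definition sym_vec :: "strop ^ 'd \<Rightarrow> symtrop ^ 'd" where
  "sym_vec v = (\<chi> i. to_sym (v $ i))"


section \<open>Halfspaces, cones and TO-convexity\<close>

text \<open>
  The coefficient vector of length \<open>d + 1\<close> is split into its constant
  term \<open>a0\<close> and the remaining entries \<open>a\<close>.
\<close>

definition halfspace :: "strop \<Rightarrow> strop ^ 'd \<Rightarrow> (strop ^ 'd) set" where
  "halfspace a0 a =
    {x. to_sym a0 + (\<Sum>i\<in>UNIV. to_sym (a $ i) * to_sym (x $ i)) \<in> tpos \<union> tbal}"

definition closed_halfspaces :: "(strop ^ 'd) set set" where
  "closed_halfspaces = {halfspace a0 a | a0 a. a \<noteq> 0}"

definition linear_closed_halfspaces :: "(strop ^ 'd) set set" where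
  "linear_closed_halfspaces = {halfspace 0 a | a. a \<noteq> 0}"

definition tcone :: "(strop ^ 'd) set \<Rightarrow> bool" where
  "tcone X \<longleftrightarrow> (\<forall>c. to_sym c \<in> tpos \<longrightarrow> (\<lambda>x. c *s x) ` X \<subseteq> X)"

definition uncertainty :: "symtrop \<Rightarrow> strop set" where
  "uncertainty s = (if s \<in> tbal then {- tnorm s .. tnorm s} else {x. to_sym x = s})"

definition uncertainty_vec :: "symtrop ^ 'd \<Rightarrow> (strop ^ 'd) set" where
  "uncertainty_vec s = {x. \<forall>i. x $ i \<in> uncertainty (s $ i)}"

definition conv_TO :: "(strop ^ 'd) set \<Rightarrow> (strop ^ 'd) set" where
  "conv_TO T =
    \<Union> {uncertainty_vec (\<Sum>v\<in>T. c v *s sym_vec v) | c :: strop ^ 'd \<Rightarrow> symtrop.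
        (\<forall>v\<in>T. c v \<in> tnonneg) \<and> (\<Sum>v\<in>T. c v) = 1}"

definition TO_convex :: "(strop ^ 'd) set \<Rightarrow> bool" where
  "TO_convex M \<longleftrightarrow> (\<forall>T. finite T \<and> T \<subseteq> M \<longrightarrow> conv_TO T \<subseteq> M)"

end

theory Submission
  imports Defs
begin

text \<open>
  The signed exponential \<open>sexp\<close>, with inverse \<open>slog\<close>, is an isomorphism of ordered multiplicative
  monoids from the signed tropical numbers onto the reals, hence a homeomorphism. Under it the
  tropical sum of finitely many numbers is negative iff some term \<open>w j\<close> satisfies
  \<open>w i + w j < 0\<close> for all \<open>i\<close>, and for odd \<open>p\<close> tending to infinity a limit of terms
  with \<open>0 \<le> (\<Sum>i. w i ^ p)\<close> has no negative tropical sum.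

  Let \<open>z\<close> lie outside the closure of \<open>X\<close>, so that some cube around \<open>z\<close> misses \<open>X\<close>, and let
  \<open>T \<subseteq> X\<close> be finite. For large odd \<open>p\<close> the ordinary convex hull of the coordinatewise
  \<open>p\<close>-th powers of \<open>T\<close> misses the \<open>p\<close>-th power of the cube, which is a box: otherwise, taking
  \<open>p\<close>-th roots of the convex coefficients, a limit point would lie in the cube and in the TO-convex
  hull of \<open>T\<close>. Separating the two by a hyperplane, taking \<open>p\<close>-th roots of its normalized
  coefficients and passing to the limit gives a closed halfspace that contains \<open>T\<close> and is weakly
  separated from the cube. By compactness of the sphere of coefficients, a single halfspace serves
  all \<open>T\<close>, and weak separation from the whole cube is strict at its centre \<open>z\<close>.
  For a cone, scaling by large and small factors shows that the constant term may be dropped.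
\<close>

section \<open>The signed exponential\<close>

lemma to_sym_cases:
  obtains "to_sym x = TZero" | r where "to_sym x = Elem Plus r" | r where "to_sym x = Elem Minus r"
  using to_sym[of x] by (auto simp: tpos_def tneg_def zero_symtrop_def)

lemma Elem_in_tpos_iff [simp]: "Elem s r \<in> tpos \<longleftrightarrow> s = Plus"
  by (auto simp: tpos_def)

lemma Elem_in_tneg_iff [simp]: "Elem s r \<in> tneg \<longleftrightarrow> s = Minus"
  by (auto simp: tneg_def)

lemma Elem_in_tbal_iff [simp]: "Elem s r \<in> tbal \<longleftrightarrow> s = Balanced"
  by (auto simp: tbal_def zero_symtrop_def)

lemma TZero_in_iff [simp]: "TZero \<notin> tpos" "TZero \<notin> tneg" "TZero \<in> tbal"
  by (auto simp: tpos_def tneg_def tbal_def zero_symtrop_def)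

text \<open>The last branch only meets \<open>Minus\<close>, since a signed number is never
  balanced.\<close>

definition sexp :: "strop \<Rightarrow> real" where
  "sexp x = (case to_sym x of TZero \<Rightarrow> 0 | Elem s r \<Rightarrow> if s = Plus then exp r else - exp r)"

lift_definition slog :: "real \<Rightarrow> strop" is
  "\<lambda>x. if x > 0 then Elem Plus (ln x) else if x < 0 then Elem Minus (ln (- x)) else TZero"
  by (auto simp: zero_symtrop_def)

lemma sexp_slog [simp]: "sexp (slog x) = x"
  by (auto simp: sexp_def slog.rep_eq)

lemma slog_sexp [simp]: "slog (sexp x) = x"
  by (rule to_sym_cases[of x]; simp add: sexp_def slog.rep_eq flip: to_sym_inject)

lemma sexp_less_iff: "sexp x < sexp y \<longleftrightarrow> x < y"
  by (rule to_sym_cases[of x]; rule to_sym_cases[of y])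
    (auto simp: sexp_def less_strop_def not_less add_pos_pos add_nonneg_pos
      intro: order.trans[of _ 0] order.strict_trans[of _ 0])

lemma sexp_le_iff: "sexp x \<le> sexp y \<longleftrightarrow> x \<le> y"
  using sexp_less_iff[of y x] by (simp add: not_less[symmetric])

lemma sexp_inject [simp]: "sexp x = sexp y \<longleftrightarrow> x = y"
  by (metis slog_sexp)

lemma sexp_mult: "sexp (x * y) = sexp x * sexp y"
  by (rule to_sym_cases[of x]; rule to_sym_cases[of y])
    (auto simp: sexp_def times_strop.rep_eq exp_add)

lemma sexp_uminus: "sexp (- x) = - sexp x"
  by (rule to_sym_cases[of x]) (auto simp: sexp_def uminus_strop.rep_eq)

lemma sexp_0 [simp]: "sexp 0 = 0"
  by (simp add: sexp_def zero_strop.rep_eq zero_symtrop_def)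

lemma sexp_1 [simp]: "sexp 1 = 1"
  by (simp add: sexp_def one_strop.rep_eq one_symtrop_def)

lemma to_sym_mult: "to_sym (x * y) = to_sym x * to_sym y"
  by (rule times_strop.rep_eq)

lemma to_sym_in_tpos_iff: "to_sym x \<in> tpos \<longleftrightarrow> sexp x > 0"
  by (rule to_sym_cases[of x]) (auto simp: sexp_def)

lemma to_sym_in_tnonneg_iff: "to_sym x \<in> tnonneg \<longleftrightarrow> sexp x \<ge> 0"
  by (rule to_sym_cases[of x]) (auto simp: sexp_def tnonneg_def zero_symtrop_def)

lemma continuous_on_sexp: "continuous_on UNIV sexp"
proof (rule continuous_onI_mono)
  have "sexp ` UNIV = UNIV"
    by (metis sexp_slog surjI)
  then show "open (sexp ` UNIV)" by simp
qed (simp add: sexp_le_iff)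

lemma continuous_on_slog: "continuous_on UNIV slog"
proof (rule continuous_on_generate_topology)
  show "(open :: strop set \<Rightarrow> bool) = generate_topology (range (\<lambda>a. {..<a}) \<union> range (\<lambda>a. {a<..}))"
    by (rule open_strop_def)
  fix B :: "strop set"
  assume "B \<in> range (\<lambda>a. {..<a}) \<union> range (\<lambda>a. {a<..})"
  then obtain a where "B = {..<a} \<or> B = {a<..}"
    by blast
  then have "slog -` B = {..<sexp a} \<or> slog -` B = {sexp a<..}"
    by (auto simp: sexp_less_iff[symmetric])
  then show "\<exists>C. open C \<and> C \<inter> UNIV = slog -` B \<inter> UNIV"
    by (metis open_lessThan open_greaterThan)
qed

section \<open>Signs of tropical sums\<close>

text \<open>Taking \<open>i = j\<close> forces \<open>w j < 0\<close>; the other inequalities say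
  that \<open>- w j\<close> exceeds every positive term. Written with strict inequalities only, this
  is an open condition in \<open>w\<close> when \<open>S\<close> is finite.\<close>

definition neg_dominated :: "'i set \<Rightarrow> ('i \<Rightarrow> real) \<Rightarrow> bool" where
  "neg_dominated S w \<longleftrightarrow> (\<exists>j\<in>S. \<forall>i\<in>S. w i + w j < 0)"

text \<open>\<open>dominance p n\<close> is the value of a tropical sum whose largest positive and negative terms have
  norms \<open>ln p\<close> and \<open>ln n\<close>; here \<open>p = 0\<close> or \<open>n = 0\<close> means that there is no such term.\<close>

definition dominance :: "real \<Rightarrow> real \<Rightarrow> symtrop" where
  "dominance p n = (if p > n then Elem Plus (ln p) else if n > p then Elem Minus (ln n)
     else if p = 0 then TZero else Elem Balanced (ln p))"

text \<open>The smaller of \<open>p\<close> and \<open>n\<close> is forgotten by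
  \<open>dominance\<close>, yet it cannot affect later sums, so the two signs can be maximized
  separately.\<close>

lemma dominance_add:
  assumes "0 \<le> p" "0 \<le> n" "0 \<le> p'" "0 \<le> n'"
  shows "dominance p n + dominance p' n' = dominance (max p p') (max n n')"
  using assms unfolding dominance_def by (auto simp: max_def not_less)

lemma to_sym_eq_dominance: "to_sym x = dominance (max 0 (sexp x)) (max 0 (- sexp x))"
  by (rule to_sym_cases[of x]) (auto simp: sexp_def dominance_def max_def)

lemma sum_to_sym_eq_dominance:
  assumes "finite S"
  shows "(\<Sum>i\<in>S. to_sym (u i)) =
    dominance (Max (insert 0 ((\<lambda>i. sexp (u i)) ` S))) (Max (insert 0 ((\<lambda>i. - sexp (u i)) ` S)))"
  using assms
proof (induction S)
  case empty
  show ?case by (simp add: dominance_def zero_symtrop_def)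
next
  case (insert i S)
  have *: "max (max 0 a) (Max (insert 0 (f ` S))) = Max (insert 0 (insert a (f ` S)))"
    for a :: real and f
    using insert.hyps by (cases "S = {}") (auto simp: max.left_commute max.assoc)
  have "0 \<le> Max (insert 0 (f ` S))" for f :: "'a \<Rightarrow> real"
    using insert.hyps by simp
  then show ?case
    using insert by (simp add: to_sym_eq_dominance[of "u i"] dominance_add * del: Max_insert)
qed

text \<open>The 0 on the left forces the winning term to be negative; the 0 on the right can never
  win.\<close>

lemma Max_less_Max_uminus_iff:
  assumes "finite S"
  shows "Max (insert 0 (w ` S)) < Max (insert 0 ((\<lambda>i. - w i) ` S)) \<longleftrightarrow> neg_dominated S w"
    (is "?l \<longleftrightarrow> _")
proof -
  have "?l \<longleftrightarrow> (\<exists>b\<in>insert 0 ((\<lambda>i. - w i) ` S). \<forall>a\<in>insert 0 (w ` S). a < b)"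
    using assms by (simp add: Max_gr_iff Max_less_iff del: Max_insert)
  also have "\<dots> \<longleftrightarrow> neg_dominated S w"
    unfolding neg_dominated_def by (force simp: algebra_simps)
  finally show ?thesis .
qed

lemma sum_to_sym_in_tneg_iff:
  assumes "finite S"
  shows "(\<Sum>i\<in>S. to_sym (u i)) \<in> tneg \<longleftrightarrow> neg_dominated S (\<lambda>i. sexp (u i))"
proof -
  have "dominance p n \<in> tneg \<longleftrightarrow> p < n" for p n
    by (auto simp: dominance_def)
  then show ?thesis
    by (simp only: sum_to_sym_eq_dominance[OF assms] Max_less_Max_uminus_iff[OF assms])
qed

lemma sum_to_sym_in_tpos_iff:
  assumes "finite S"
  shows "(\<Sum>i\<in>S. to_sym (u i)) \<in> tpos \<longleftrightarrow> neg_dominated S (\<lambda>i. - sexp (u i))"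
proof -
  have "dominance p n \<in> tpos \<longleftrightarrow> n < p" for p n
    by (auto simp: dominance_def)
  then show ?thesis
    using Max_less_Max_uminus_iff[OF assms, of "\<lambda>i. - sexp (u i)"]
    by (simp only: sum_to_sym_eq_dominance[OF assms] minus_minus)
qed

section \<open>Balance and uncertainty sets\<close>

lemma in_tbal_iff: "s \<in> tbal \<longleftrightarrow> s \<notin> tpos \<and> s \<notin> tneg"
  by (cases s) (auto, metis tsign.exhaust)

lemma in_tpos_Un_tbal_iff: "s \<in> tpos \<union> tbal \<longleftrightarrow> s \<notin> tneg"
  by (cases s) (auto, metis tsign.exhaust)

text \<open>A balanced \<open>s\<close> stays balanced after adding \<open>- y\<close> iff its norm
  is at least that of \<open>y\<close>; any other \<open>s\<close> becomes balanced only for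
  \<open>y = s\<close>. Membership is thus a sign condition on a sum with one extra term.\<close>

lemma in_uncertainty_iff: "y \<in> uncertainty s \<longleftrightarrow> to_sym (- y) + s \<in> tbal"
proof (cases s)
  case TZero
  have "tnorm TZero = 0" "- (0::strop) = 0"
    by (simp_all add: tnorm.rep_eq zero_strop.rep_eq uminus_strop.rep_eq zero_symtrop_def
        flip: to_sym_inject)
  then have "uncertainty s = {0}"
    by (simp add: uncertainty_def TZero)
  then show ?thesis
    by (rule_tac to_sym_cases[of y]; simp add: TZero uminus_strop.rep_eq zero_strop.rep_eq
        zero_symtrop_def flip: to_sym_inject)
next
  case (Elem t r)
  have "sexp (tnorm (Elem t r)) = exp r"
    by (simp add: sexp_def tnorm.rep_eq)
  then have "uncertainty (Elem Balanced r) = {x. - exp r \<le> sexp x \<and> sexp x \<le> exp r}" if "t = Balanced"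
    using that by (auto simp: uncertainty_def sexp_uminus simp flip: sexp_le_iff)
  then show ?thesis
    by (cases t; rule_tac to_sym_cases[of y])
      (auto simp: Elem uncertainty_def sexp_def uminus_strop.rep_eq not_less
        intro: order.trans[of _ 0])
qed

section \<open>Halfspaces and tropical hulls in homogeneous coordinates\<close>

text \<open>Index \<open>None\<close> holds the constant coordinate: \<open>a0\<close> for a
  coefficient vector, 1 for a point. A tropical affine form then has the products of two such
  vectors as its terms.\<close>

definition homvec :: "strop \<Rightarrow> strop ^ 'd \<Rightarrow> real ^ 'd option" where
  "homvec x0 x = (\<chi> i. case i of None \<Rightarrow> sexp x0 | Some j \<Rightarrow> sexp (x $ j))"

lemma homvec_nth [simp]: "homvec x0 x $ None = sexp x0" "homvec x0 x $ Some j = sexp (x $ j)"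
  by (simp_all add: homvec_def)

lemma ex_homvec: "\<exists>x0 x. homvec x0 x = v"
  by (rule exI[of _ "slog (v $ None)"], rule exI[of _ "\<chi> j. slog (v $ Some j)"])
    (auto simp: vec_eq_iff homvec_def split: option.split)

lemma in_halfspace_iff:
  "x \<in> halfspace a0 a \<longleftrightarrow> \<not> neg_dominated UNIV (\<lambda>i. homvec a0 a $ i * homvec 1 x $ i)"
proof -
  define u where "u = case_option a0 (\<lambda>j. a $ j * x $ j)"
  have "to_sym a0 + (\<Sum>i\<in>UNIV. to_sym (a $ i) * to_sym (x $ i)) = (\<Sum>i\<in>UNIV. to_sym (u i))"
    by (simp add: UNIV_option_conv sum.reindex u_def to_sym_mult)
  moreover have "sexp (u i) = homvec a0 a $ i * homvec 1 x $ i" for i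
    by (cases i) (simp_all add: u_def sexp_mult)
  ultimately show ?thesis
    by (simp add: halfspace_def in_tpos_Un_tbal_iff sum_to_sym_in_tneg_iff del: Un_iff)
qed

lemma in_uncertainty_sum_iff:
  fixes u :: "'i \<Rightarrow> strop" and y :: strop
  assumes "finite T" and w: "w None = - sexp y" "\<And>v. w (Some v) = sexp (u v)"
  shows "y \<in> uncertainty (\<Sum>v\<in>T. to_sym (u v)) \<longleftrightarrow>
    \<not> neg_dominated (insert None (Some ` T)) w \<and>
    \<not> neg_dominated (insert None (Some ` T)) (\<lambda>i. - w i)"
proof -
  let ?A = "insert None (Some ` T)"
  have "to_sym (- y) + (\<Sum>v\<in>T. to_sym (u v)) = (\<Sum>i\<in>?A. to_sym (case_option (- y) u i))"
    using assms by (simp add: sum.reindex)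
  moreover have "sexp (case_option (- y) u i) = w i" for i
    by (simp add: w sexp_uminus split: option.split)
  moreover have "finite ?A" using assms by simp
  ultimately show ?thesis
    unfolding in_uncertainty_iff in_tbal_iff
    by (auto simp only: sum_to_sym_in_tpos_iff sum_to_sym_in_tneg_iff)
qed

lemma sum_tnonneg: "(\<And>v. v \<in> T \<Longrightarrow> c v \<in> tnonneg) \<Longrightarrow> sum c T \<in> tnonneg"
proof (induction T rule: infinite_finite_induct)
  case (insert v T)
  have "s + t \<in> tnonneg" if "s \<in> tnonneg" "t \<in> tnonneg" for s t
    using that by (cases s; cases t) (auto simp: tnonneg_def zero_symtrop_def)
  then show ?case using insert by simp
qed (auto simp: tnonneg_def)

text \<open>A nonzero nonnegative element is not balanced, so its uncertainty set is a single point.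
  This turns a balance condition on the coefficients into the exact equation that they sum to
  1.\<close>

lemma eq_to_sym_of_uncertainty:
  assumes "s \<in> tnonneg" "y \<in> uncertainty s"
  shows "s = to_sym y"
proof (cases "s = 0")
  case True
  then have "to_sym (- y) \<in> tbal"
    using assms(2) by (simp add: in_uncertainty_iff)
  then show ?thesis
    by (rule_tac to_sym_cases[of y])
      (simp_all add: True zero_symtrop_def uminus_strop.rep_eq)
next
  case False
  then show ?thesis
    using assms by (auto simp: uncertainty_def tnonneg_def in_tbal_iff)
qed

text \<open>The coordinate \<open>i = None\<close> of the hypotheses encodes that the coefficients sum to 1.\<close>

lemma in_conv_TO_I:
  fixes y :: "strop ^ 'd"
  assumes T: "finite T" and m: "\<And>v. v \<in> T \<Longrightarrow> 0 \<le> m v"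
    and w: "\<And>i v. w i (Some v) = m v * homvec 1 v $ i" "\<And>i. w i None = - homvec 1 y $ i"
    and nd: "\<And>i. \<not> neg_dominated (insert None (Some ` T)) (w i)"
      "\<And>i. \<not> neg_dominated (insert None (Some ` T)) (\<lambda>j. - w i j)"
  shows "y \<in> conv_TO T"
proof -
  define c where "c v = to_sym (slog (m v))" for v
  have c: "c v \<in> tnonneg" if "v \<in> T" for v
    using m[OF that] by (simp add: c_def to_sym_in_tnonneg_iff)
  have "1 \<in> uncertainty (\<Sum>v\<in>T. c v)"
    using nd[of None] by (simp add: in_uncertainty_sum_iff[OF T, of "w None"] c_def w)
  then have "(\<Sum>v\<in>T. c v) = 1"
    using eq_to_sym_of_uncertainty[OF sum_tnonneg, of T c 1] c by (simp add: one_strop.rep_eq)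
  moreover have "y \<in> uncertainty_vec (\<Sum>v\<in>T. c v *s sym_vec v)"
  proof -
    have "y $ j \<in> uncertainty (\<Sum>v\<in>T. to_sym (slog (m v) * v $ j))" for j
      using nd[of "Some j"]
      by (simp add: in_uncertainty_sum_iff[OF T, of "w (Some j)"] w sexp_mult)
    then show ?thesis
      by (simp add: uncertainty_vec_def sym_vec_def c_def to_sym_mult)
  qed
  ultimately show ?thesis
    using c unfolding conv_TO_def by blast
qed

lemma open_neg_dominated:
  fixes f :: "'a :: topological_space \<Rightarrow> 'i \<Rightarrow> real"
  assumes "finite S" "\<And>i. i \<in> S \<Longrightarrow> continuous_on UNIV (\<lambda>x. f x i)"
  shows "open {x. neg_dominated S (f x)}"
proof -
  have "{x. neg_dominated S (f x)} = (\<Union>j\<in>S. \<Inter>i\<in>S. {x. f x i + f x j < 0})"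
    by (auto simp: neg_dominated_def)
  moreover have "open {x. f x i + f x j < 0}" if "i \<in> S" "j \<in> S" for i j
    using assms that by (intro open_Collect_less continuous_intros) auto
  ultimately show ?thesis
    using assms(1) by (auto intro!: open_INT)
qed

lemma continuous_on_sexp_comp [continuous_intros]:
  "continuous_on S f \<Longrightarrow> continuous_on S (\<lambda>x. sexp (f x))"
  by (rule continuous_on_compose2[OF continuous_on_sexp]) auto

lemma closed_halfspace: "closed (halfspace a0 a)"
proof -
  have "continuous_on UNIV (\<lambda>x. homvec a0 a $ i * homvec 1 x $ i)" for i
    by (cases i) (auto intro!: continuous_intros)
  then have "open {x. neg_dominated UNIV (\<lambda>i. homvec a0 a $ i * homvec 1 x $ i)}"
    by (intro open_neg_dominated) auto
  moreover have "- halfspace a0 a = {x. neg_dominated UNIV (\<lambda>i. homvec a0 a $ i * homvec 1 x $ i)}"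
    by (auto simp: in_halfspace_iff)
  ultimately show ?thesis
    by (simp add: closed_def)
qed

section \<open>Dequantization\<close>

text \<open>Maslov dequantization: for large odd exponents the sign of a sum of powers is governed by
  the terms of largest absolute value.\<close>

lemma not_neg_dominated_limit:
  fixes w :: "nat \<Rightarrow> 'i \<Rightarrow> real"
  assumes S: "finite S" and lim: "\<And>i. i \<in> S \<Longrightarrow> (\<lambda>k. w k i) \<longlonglongrightarrow> l i"
    and p: "filterlim p at_top sequentially" "\<And>k. odd (p k)"
    and nonneg: "\<And>k. 0 \<le> (\<Sum>i\<in>S. w k i ^ p k)"
  shows "\<not> neg_dominated S l"
proof
  assume "neg_dominated S l"
  then obtain j where j: "j \<in> S" "\<forall>i\<in>S. l i + l j < 0"
    by (auto simp: neg_dominated_def)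
  define M where "M = Max (insert 0 (l ` S))"
  have "M < - l j"
    using S j by (force simp: M_def simp del: Max_insert)
  \<comment> \<open>Two levels are needed: eventually all terms lie below \<open>c\<close> while
    term \<open>j\<close> lies below \<open>- c'\<close>, and the powers of
    \<open>c' / c > 1\<close> outgrow the number of terms.\<close>
  then obtain c where c: "M < c" "c < - l j"
    using dense by blast
  then obtain c' where c': "c < c'" "c' < - l j"
    using dense by blast
  have lc: "l i < c" if "i \<in> S" for i
    using S that c(1) by (auto simp: M_def simp del: Max_insert)
  have "0 < c"
    using S c(1) by (auto simp: M_def simp del: Max_insert)
  have "\<forall>\<^sub>F k in sequentially. \<forall>i\<in>S. w k i < c"
    using S by (intro eventually_ball_finite ballI order_tendstoD(2)[OF lim] lc) auto
  moreover have "\<forall>\<^sub>F k in sequentially. w k j < - c'"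
    using c' j by (intro order_tendstoD(2)[OF lim]) auto
  moreover have "\<forall>\<^sub>F k in sequentially. real (card S) < (c' / c) ^ p k"
  proof -
    have "1 < c' / c"
      using c' \<open>0 < c\<close> by simp
    then obtain n where n: "real (card S) < (c' / c) ^ n"
      using real_arch_pow by blast
    have "\<forall>\<^sub>F k in sequentially. n \<le> p k"
      using p(1) by (simp add: filterlim_at_top)
    then show ?thesis
    proof eventually_elim
      case (elim k)
      then show ?case
        using n power_increasing[OF elim, of "c' / c"] \<open>1 < c' / c\<close> by linarith
    qed
  qed
  ultimately have "\<forall>\<^sub>F k in sequentially. False"
  proof eventually_elim
    case (elim k)
    have "w k j ^ p k \<le> - (c' ^ p k)"
      using power_mono_odd[of "p k" "w k j" "- c'"] p elim by simp
    \<comment> \<open>Odd powers are monotone on all reals, so the upper bound \<open>c\<close>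
      suffices even for negative terms.\<close>
    moreover have "(\<Sum>i\<in>S - {j}. w k i ^ p k) \<le> (\<Sum>i\<in>S - {j}. c ^ p k)"
      using elim p by (intro sum_mono power_mono_odd) (auto intro: less_imp_le)
    moreover have "\<dots> \<le> real (card S) * c ^ p k"
      using S \<open>0 < c\<close> by (auto intro!: mult_right_mono card_mono)
    moreover have "real (card S) * c ^ p k < c' ^ p k"
      using elim \<open>0 < c\<close> by (simp add: power_divide field_simps)
    ultimately have "(\<Sum>i\<in>S. w k i ^ p k) < 0"
      using S j by (simp add: sum.remove)
    then show ?case
      using nonneg[of k] by simp
  qed
  then show False by simp
qed

text \<open>Bolzano-Weierstrass for one index after another, thinning the subsequence each
  time.\<close>

lemma convergent_subsequence_finite_family:
  fixes f :: "nat \<Rightarrow> 'i \<Rightarrow> real"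
  assumes "finite I" "\<And>i. i \<in> I \<Longrightarrow> bounded (range (\<lambda>k. f k i))"
  shows "\<exists>r l. strict_mono (r :: nat \<Rightarrow> nat) \<and> (\<forall>i\<in>I. (\<lambda>k. f (r k) i) \<longlonglongrightarrow> l i)"
  using assms
proof (induction I)
  case empty
  show ?case by (auto intro: strict_mono_id)
next
  case (insert i I)
  then obtain r l where r: "strict_mono (r :: nat \<Rightarrow> nat)" "\<forall>j\<in>I. (\<lambda>k. f (r k) j) \<longlonglongrightarrow> l j"
    by auto
  have "bounded (range (\<lambda>k. f (r k) i))"
    using insert.prems[of i] by (auto intro: bounded_subset)
  then obtain s a where s: "strict_mono s" "((\<lambda>k. f (r k) i) \<circ> s) \<longlonglongrightarrow> a"
    using bounded_imp_convergent_subsequence by blast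
  have "(\<lambda>k. f ((r \<circ> s) k) j) \<longlonglongrightarrow> (l(i := a)) j" if "j \<in> insert i I" for j
  proof (cases "j = i")
    case True
    then show ?thesis using s by (simp add: o_def)
  next
    case False
    then show ?thesis
      using LIMSEQ_subseq_LIMSEQ[OF _ s(1), of "\<lambda>k. f (r k) j"] r that by (auto simp: o_def)
  qed
  then show ?case
    using strict_mono_o[OF r(1) s(1)] by blast
qed

section \<open>From tropical hulls to ordinary convex hulls of powers\<close>

text \<open>Measured in the real coordinates \<open>sexp\<close>. The product shape survives
  coordinatewise odd powers, so the image remains convex.\<close>

definition cube :: "strop ^ 'd \<Rightarrow> real \<Rightarrow> (strop ^ 'd) set" where
  "cube z e = {y. \<forall>j. \<bar>sexp (y $ j) - sexp (z $ j)\<bar> \<le> e}"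

text \<open>For \<open>i = None\<close>, \<open>eq\<close> says that the coefficients sum to 1, so
  their \<open>p\<close>-th roots lie between 0 and 1. Roots and points converge along a common
  subsequence, and the power identities become balance conditions in the limit.\<close>

lemma in_conv_TO_limit:
  fixes y :: "nat \<Rightarrow> strop ^ 'd"
  assumes T: "finite T"
    and p: "filterlim p at_top sequentially" "\<And>k. odd (p k)"
    and y: "\<And>k. y k \<in> cube z e"
    and c: "\<And>k v. v \<in> T \<Longrightarrow> 0 \<le> c k v"
    and eq: "\<And>k i. (\<Sum>v\<in>T. c k v * homvec 1 v $ i ^ p k) = homvec 1 (y k) $ i ^ p k"
  shows "conv_TO T \<inter> cube z e \<noteq> {}"
proof -
  define m where "m k v = root (p k) (c k v)" for k v
  have p0: "0 < p k" for k
    using p(2) by (simp add: odd_pos)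
  have m_pow: "m k v ^ p k = c k v" for k v
    using p by (simp add: m_def odd_real_root_pow)
  have m0: "0 \<le> m k v" if "v \<in> T" for k v
    using p0 c[OF that] by (simp add: m_def)
  have "c k v \<le> 1" if "v \<in> T" for k v
    using member_le_sum[of v T "c k"] that T c eq[of k None] by auto
  then have m1: "m k v \<le> 1" if "v \<in> T" for k v
    using that p0[of k] by (simp add: m_def)
  define f where "f k = case_sum (m k) (\<lambda>j. sexp (y k $ j))" for k
  let ?I = "Inl ` T \<union> range Inr"
  have "bounded (range (\<lambda>k. f k i))" if "i \<in> ?I" for i
  proof -
    consider v where "i = Inl v" "v \<in> T" | j where "i = Inr j"
      using \<open>i \<in> ?I\<close> by auto
    then show ?thesis
    proof cases
      case 1
      then show ?thesis
        using m0 m1 by (auto intro!: boundedI[of _ 1] simp: f_def)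
    next
      case (2 j)
      have "\<bar>sexp (y k $ j)\<bar> \<le> \<bar>sexp (z $ j)\<bar> + e" for k
        using y[of k] unfolding cube_def by (auto dest!: spec[of _ j])
      then show ?thesis
        by (auto intro!: boundedI[of _ "\<bar>sexp (z $ j)\<bar> + e"] simp: f_def 2)
    qed
  qed
  then obtain r l where r: "strict_mono (r :: nat \<Rightarrow> nat)"
    and l: "\<forall>i\<in>?I. (\<lambda>k. f (r k) i) \<longlonglongrightarrow> l i"
    using convergent_subsequence_finite_family[of ?I f] T by auto
  have lm: "(\<lambda>k. m (r k) v) \<longlonglongrightarrow> l (Inl v)" if "v \<in> T" for v
    using l that by (auto simp: f_def dest: bspec[of _ _ "Inl v"])
  have ly: "(\<lambda>k. sexp (y (r k) $ j)) \<longlonglongrightarrow> l (Inr j)" for j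
    using l by (auto simp: f_def dest: bspec[of _ _ "Inr j"])
  define y' where "y' = (\<chi> j. slog (l (Inr j)))"
  have lh: "(\<lambda>k. homvec 1 (y (r k)) $ i) \<longlonglongrightarrow> homvec 1 y' $ i" for i
    using ly by (cases i) (simp_all add: y'_def)
  have "\<bar>sexp (y' $ j) - sexp (z $ j)\<bar> \<le> e" for j
  proof (rule LIMSEQ_le_const2)
    show "(\<lambda>k. \<bar>sexp (y (r k) $ j) - sexp (z $ j)\<bar>) \<longlonglongrightarrow> \<bar>sexp (y' $ j) - sexp (z $ j)\<bar>"
      using ly[of j] by (auto simp: y'_def intro!: tendsto_intros)
    show "\<exists>N. \<forall>n\<ge>N. \<bar>sexp (y (r n) $ j) - sexp (z $ j)\<bar> \<le> e"
      using y by (auto simp: cube_def)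
  qed
  then have "y' \<in> cube z e"
    by (simp add: cube_def)
  moreover have "y' \<in> conv_TO T"
  proof (rule in_conv_TO_I[OF T])
    let ?A = "insert None (Some ` T)"
    define w where "w i = case_option (- homvec 1 y' $ i) (\<lambda>v. l (Inl v) * homvec 1 v $ i)" for i
    show "w i (Some v) = l (Inl v) * homvec 1 v $ i" "w i None = - homvec 1 y' $ i" for i v
      by (simp_all add: w_def)
    show "0 \<le> l (Inl v)" if "v \<in> T" for v
      using m0 that by (intro LIMSEQ_le_const[OF lm]) auto
    fix i
    \<comment> \<open>With the right-hand side of \<open>eq\<close> moved to the left, the powers
      sum to exactly 0, so the limit lemma applies to \<open>W\<close> and to its negative.\<close>
    define W where "W k = case_option (- homvec 1 (y (r k)) $ i) (\<lambda>v. m (r k) v * homvec 1 v $ i)" for k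
    have W: "(\<lambda>k. W k j) \<longlonglongrightarrow> w i j" if "j \<in> ?A" for j
      using that lh[of i] lm by (auto simp: W_def w_def intro!: tendsto_intros)
    have sum: "(\<Sum>j\<in>?A. W k j ^ p (r k)) = 0" for k
      using T p(2)[of "r k"] eq[where k = "r k" and i = i]
      by (simp add: sum.reindex W_def power_mult_distrib m_pow)
    have pr: "filterlim (\<lambda>k. p (r k)) at_top sequentially"
      by (rule filterlim_compose[OF p(1) filterlim_subseq[OF r]])
    show "\<not> neg_dominated ?A (w i)"
      by (rule not_neg_dominated_limit[of _ W, OF _ W pr]) (use T p sum in auto)
    show "\<not> neg_dominated ?A (\<lambda>j. - w i j)"
    proof (rule not_neg_dominated_limit[of _ "\<lambda>k j. - W k j", OF _ tendsto_minus[OF W] pr])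
      show "0 \<le> (\<Sum>j\<in>?A. (- W k j) ^ p (r k))" for k
        using p(2)[of "r k"] sum[of k] by (simp add: sum_negf del: sum.insert)
    qed (use T p in auto)
  qed
  ultimately show ?thesis by blast
qed

definition spower :: "nat \<Rightarrow> strop ^ 'd \<Rightarrow> real ^ 'd" where
  "spower p y = (\<chi> j. sexp (y $ j) ^ p)"

lemma inj_spower: "odd p \<Longrightarrow> inj (spower p)"
  by (rule injI) (metis spower_def vec_eq_iff vec_lambda_beta odd_real_root_power_cancel sexp_inject)

text \<open>An odd power is an increasing bijection of the reals, so it maps each edge onto an
  interval.\<close>

lemma spower_cube:
  assumes p: "odd p"
  shows "spower p ` cube z e =
    cbox (\<chi> j. (sexp (z $ j) - e) ^ p) (\<chi> j. (sexp (z $ j) + e) ^ p)"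
    (is "_ = ?B")
proof (intro equalityI subsetI)
  fix u assume "u \<in> spower p ` cube z e"
  then obtain y where y: "y \<in> cube z e" "u = spower p y" by blast
  have "sexp (z $ j) - e \<le> sexp (y $ j)" "sexp (y $ j) \<le> sexp (z $ j) + e" for j
    using y(1) by (auto simp: cube_def abs_le_iff algebra_simps dest: spec[of _ j])
  then show "u \<in> ?B"
    using p by (simp add: y mem_box_cart spower_def power_mono_odd)
next
  fix u assume u: "u \<in> ?B"
  define y where "y = (\<chi> j. slog (root p (u $ j)))"
  have p0: "0 < p" using p by (simp add: odd_pos)
  have "sexp (z $ j) - e \<le> root p (u $ j)" "root p (u $ j) \<le> sexp (z $ j) + e" for j
    using u real_root_le_mono[OF p0, of "(sexp (z $ j) - e) ^ p" "u $ j"]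
      real_root_le_mono[OF p0, of "u $ j" "(sexp (z $ j) + e) ^ p"]
    by (auto simp: mem_box_cart odd_real_root_power_cancel[OF p])
  then have "y \<in> cube z e"
    by (simp add: cube_def y_def abs_le_iff algebra_simps)
  moreover have "u = spower p y"
    by (simp add: vec_eq_iff spower_def y_def odd_real_root_pow[OF p])
  ultimately show "u \<in> spower p ` cube z e" by blast
qed

lemma eventually_spower_disjoint:
  assumes T: "finite T" and disj: "conv_TO T \<inter> cube z e = {}"
  shows "\<exists>K. \<forall>k\<ge>K. convex hull (spower (2 * k + 1) ` T) \<inter> spower (2 * k + 1) ` cube z e = {}"
proof (rule ccontr)
  assume "\<not> ?thesis"
  then have "\<forall>K. \<exists>k y. K \<le> k \<and> y \<in> cube z e \<and> spower (2 * k + 1) y \<in> convex hull (spower (2 * k + 1) ` T)"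
    by fastforce
  then obtain q y where q: "K \<le> q K" and y: "y K \<in> cube z e"
    and hull: "spower (2 * q K + 1) (y K) \<in> convex hull (spower (2 * q K + 1) ` T)" for K
    by metis
  define p where "p K = 2 * q K + 1" for K
  have odd: "odd (p K)" for K
    by (simp add: p_def)
  have p_lim: "filterlim p at_top sequentially"
  proof (rule filterlim_at_top_mono[OF filterlim_ident])
    show "\<forall>\<^sub>F K in sequentially. K \<le> p K"
      using q by (intro always_eventually allI) (simp add: p_def trans_le_add1 le_trans[OF q])
  qed
  have "\<forall>K. \<exists>c. (\<forall>v\<in>T. 0 \<le> c v) \<and> (\<Sum>v\<in>T. c v) = 1 \<and>
      (\<Sum>v\<in>T. c v *\<^sub>R spower (p K) v) = spower (p K) (y K)"
  proof
    fix K
    obtain u where u: "\<forall>x\<in>spower (p K) ` T. 0 \<le> u x" "sum u (spower (p K) ` T) = 1"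
      "(\<Sum>x\<in>spower (p K) ` T. u x *\<^sub>R x) = spower (p K) (y K)"
      using hull[of K] T by (auto simp: convex_hull_finite p_def)
    have "inj_on (spower (p K)) T"
      using inj_spower[OF odd] by (auto intro: inj_on_subset)
    then show "\<exists>c. (\<forall>v\<in>T. 0 \<le> c v) \<and> (\<Sum>v\<in>T. c v) = 1 \<and>
        (\<Sum>v\<in>T. c v *\<^sub>R spower (p K) v) = spower (p K) (y K)"
      using u by (intro exI[of _ "u \<circ> spower (p K)"]) (simp add: sum.reindex)
  qed
  then obtain c where c: "\<forall>v\<in>T. 0 \<le> c K v" "(\<Sum>v\<in>T. c K v) = 1"
    "(\<Sum>v\<in>T. c K v *\<^sub>R spower (p K) v) = spower (p K) (y K)" for K
    by metis
  have "(\<Sum>v\<in>T. c K v * homvec 1 v $ i ^ p K) = homvec 1 (y K) $ i ^ p K" for K i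
  proof (cases i)
    case None
    then show ?thesis using c(2)[of K] by simp
  next
    case (Some j)
    have "(\<Sum>v\<in>T. c K v *\<^sub>R spower (p K) v) $ j = spower (p K) (y K) $ j"
      using c(3)[of K] by simp
    then show ?thesis by (simp add: Some spower_def)
  qed
  then show False
    using in_conv_TO_limit[OF T p_lim odd, of y z e c] y c(1) disj by blast
qed

section \<open>Separation\<close>

lemma finite_separation:
  fixes z :: "strop ^ 'd"
  assumes T: "finite T" "T \<noteq> {}" and disj: "conv_TO T \<inter> cube z e = {}"
  shows "\<exists>a\<in>sphere 0 1. (\<forall>v\<in>T. \<not> neg_dominated UNIV (\<lambda>i. a $ i * homvec 1 v $ i)) \<and>
    (\<forall>y\<in>cube z e. \<not> neg_dominated UNIV (\<lambda>i. - (a $ i * homvec 1 y $ i)))"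
proof -
  obtain K where K: "\<And>k. K \<le> k \<Longrightarrow>
      convex hull (spower (2 * k + 1) ` T) \<inter> spower (2 * k + 1) ` cube z e = {}"
    using eventually_spower_disjoint[OF T(1) disj] by blast
  define p where "p k = 2 * (K + k) + 1" for k
  have odd: "odd (p k)" for k
    by (simp add: p_def)
  have p_lim: "filterlim p at_top sequentially"
    by (rule filterlim_at_top_mono[OF filterlim_ident]) (simp add: p_def)
  have "\<forall>k. \<exists>a. a \<in> sphere 0 1 \<and> (\<forall>v\<in>T. 0 < (\<Sum>i\<in>UNIV. (a $ i * homvec 1 v $ i) ^ p k)) \<and>
    (\<forall>y\<in>cube z e. (\<Sum>i\<in>UNIV. (a $ i * homvec 1 y $ i) ^ p k) < 0)"
  proof
    fix k
    let ?P = "p k"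
    have "\<exists>a b. (\<forall>x\<in>spower ?P ` cube z e. inner a x < b) \<and> (\<forall>x\<in>convex hull (spower ?P ` T). b < inner a x)"
    proof (rule separating_hyperplane_closed_compact)
      show "convex (spower ?P ` cube z e)" "closed (spower ?P ` cube z e)"
        by (simp_all add: spower_cube[OF odd] closed_cbox)
      show "compact (convex hull (spower ?P ` T))" "convex hull (spower ?P ` T) \<noteq> {}"
        using T by (simp_all add: finite_imp_compact_convex_hull)
      show "spower ?P ` cube z e \<inter> convex hull (spower ?P ` T) = {}"
        using K[of "K + k"] by (simp add: p_def Int_commute)
    qed simp
    then obtain a b where "\<forall>x\<in>spower ?P ` cube z e. inner a x < b"
      "\<forall>x\<in>convex hull (spower ?P ` T). b < inner a x"
      by blast
    then have ab: "\<forall>y\<in>cube z e. inner a (spower ?P y) < b"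
      "\<forall>v\<in>T. b < inner a (spower ?P v)"
      by (auto intro: hull_inc)
    \<comment> \<open>The powers of these roots restore the affine functional
      \<open>inner a x - b\<close>, with \<open>- b\<close> as its constant coefficient.\<close>
    define \<beta> :: "real ^ 'd option" where
      "\<beta> = (\<chi> i. case i of None \<Rightarrow> root ?P (- b) | Some j \<Rightarrow> root ?P (a $ j))"
    have sum: "(\<Sum>i\<in>UNIV. (s * \<beta> $ i * homvec 1 v $ i) ^ ?P) = s ^ ?P * (inner a (spower ?P v) - b)"
      for s v
      using odd[of k]
      by (simp add: UNIV_option_conv sum.reindex \<beta>_def power_mult_distrib odd_real_root_pow
          inner_vec_def spower_def right_diff_distrib sum_distrib_left mult.assoc)
    \<comment> \<open>Otherwise the functional would vanish at a point of \<open>T\<close>, where it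
      is positive.\<close>
    have "\<beta> \<noteq> 0"
    proof
      assume "\<beta> = 0"
      obtain v where v: "v \<in> T" using T by blast
      show False
        using sum[of 1 v] bspec[OF ab(2) v] \<open>\<beta> = 0\<close> odd_pos[OF odd, of k] by (simp add: power_0_left)
    qed
    \<comment> \<open>Scaling multiplies the sum by \<open>s ^ ?P > 0\<close>, preserving signs, and
      puts the coefficients on the compact sphere, where a limit cannot vanish.\<close>
    define s where "s = inverse (norm \<beta>)"
    have "s > 0"
      using \<open>\<beta> \<noteq> 0\<close> by (simp add: s_def)
    have *: "(\<Sum>i\<in>UNIV. ((s *\<^sub>R \<beta>) $ i * homvec 1 v $ i) ^ ?P) = s ^ ?P * (inner a (spower ?P v) - b)"
      for v
      unfolding vector_scaleR_component real_scaleR_def by (rule sum)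
    have "s *\<^sub>R \<beta> \<in> sphere 0 1"
      using \<open>\<beta> \<noteq> 0\<close> by (simp add: s_def)
    moreover have "0 < (\<Sum>i\<in>UNIV. ((s *\<^sub>R \<beta>) $ i * homvec 1 v $ i) ^ ?P)" if "v \<in> T" for v
      using ab that \<open>s > 0\<close> *[of v] by simp
    moreover have "(\<Sum>i\<in>UNIV. ((s *\<^sub>R \<beta>) $ i * homvec 1 y $ i) ^ ?P) < 0" if "y \<in> cube z e" for y
      using ab that \<open>s > 0\<close> *[of y] by (simp add: mult_pos_neg)
    ultimately show "\<exists>a. a \<in> sphere 0 1 \<and>
        (\<forall>v\<in>T. 0 < (\<Sum>i\<in>UNIV. (a $ i * homvec 1 v $ i) ^ p k)) \<and>
        (\<forall>y\<in>cube z e. (\<Sum>i\<in>UNIV. (a $ i * homvec 1 y $ i) ^ p k) < 0)"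
      by blast
  qed
  from choice[OF this] obtain \<alpha> where \<alpha>: "\<And>k. \<alpha> k \<in> sphere 0 1"
    "\<And>k v. v \<in> T \<Longrightarrow> 0 < (\<Sum>i\<in>UNIV. (\<alpha> k $ i * homvec 1 v $ i) ^ p k)"
    "\<And>k y. y \<in> cube z e \<Longrightarrow> (\<Sum>i\<in>UNIV. (\<alpha> k $ i * homvec 1 y $ i) ^ p k) < 0"
    by blast
  obtain a r where a: "a \<in> sphere 0 1" and r: "strict_mono (r :: nat \<Rightarrow> nat)"
    and lim: "(\<alpha> \<circ> r) \<longlonglongrightarrow> a"
  proof (rule seq_compactE)
    show "seq_compact (sphere (0 :: real ^ 'd option) 1)"
      by (rule compact_imp_seq_compact) (rule compact_sphere)
    show "\<forall>k. \<alpha> k \<in> sphere 0 1"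
      using \<alpha>(1) by blast
  qed
  have lim': "(\<lambda>k. \<alpha> (r k) $ i * homvec 1 v $ i) \<longlonglongrightarrow> a $ i * homvec 1 v $ i" for v i
    using tendsto_vec_nth[OF lim, of i] by (auto simp: o_def intro!: tendsto_intros)
  have pr: "filterlim (\<lambda>k. p (r k)) at_top sequentially"
    by (rule filterlim_compose[OF p_lim filterlim_subseq[OF r]])
  have "\<not> neg_dominated UNIV (\<lambda>i. a $ i * homvec 1 v $ i)" if "v \<in> T" for v
    by (rule not_neg_dominated_limit[OF _ lim' pr]) (use odd \<alpha>(2)[OF that] in \<open>auto intro: less_imp_le\<close>)
  moreover have "\<not> neg_dominated UNIV (\<lambda>i. - (a $ i * homvec 1 y $ i))" if "y \<in> cube z e" for y
    by (rule not_neg_dominated_limit[OF _ tendsto_minus[OF lim'] pr])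
      (use odd \<alpha>(3)[OF that] in \<open>auto simp: sum_negf intro: less_imp_le\<close>)
  ultimately show ?thesis
    using a by blast
qed

section \<open>Separating a point from an arbitrary TO-convex set\<close>

lemma exists_cube_disjoint:
  fixes z :: "strop ^ 'd"
  assumes "z \<notin> closure X"
  shows "\<exists>e>0. cube z e \<inter> X = {}"
proof -
  define g where "g u = (\<chi> j. slog (u $ j))" for u :: "real ^ 'd"
  have "continuous_on UNIV (\<lambda>u :: real ^ 'd. slog (u $ j))" for j
    by (rule continuous_on_compose2[OF continuous_on_slog]) (auto intro!: continuous_intros)
  then have "continuous_on UNIV g"
    unfolding g_def by (rule continuous_on_vec_lambda)
  then have "open (g -` (- closure X))"
    by (intro open_vimage) auto
  moreover have gs: "g (\<chi> j. sexp (y $ j)) = y" for y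
    by (simp add: g_def)
  ultimately obtain \<delta> where \<delta>: "\<delta> > 0" "ball (\<chi> j. sexp (z $ j)) \<delta> \<subseteq> g -` (- closure X)"
    using assms by (metis ComplI open_contains_ball vimage_eq)
  \<comment> \<open>The Euclidean norm is at most the sum of the coordinates' absolute values; the 2
    makes the bound strict.\<close>
  define e where "e = \<delta> / (2 * CARD('d))"
  have "y \<notin> X" if "y \<in> cube z e" for y
  proof -
    let ?d = "(\<chi> j. sexp (y $ j)) - (\<chi> j. sexp (z $ j)) :: real ^ 'd"
    have "norm ?d \<le> (\<Sum>j\<in>UNIV. \<bar>?d $ j\<bar>)"
      by (rule norm_le_l1_cart)
    also have "\<dots> \<le> of_nat CARD('d) * e"
      using that by (intro sum_bounded_above) (simp add: cube_def)
    also have "\<dots> < \<delta>"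
      using \<delta>(1) by (simp add: e_def)
    finally have "(\<chi> j. sexp (y $ j)) \<in> ball (\<chi> j. sexp (z $ j)) \<delta>"
      by (simp add: dist_norm norm_minus_commute)
    then have "y \<notin> closure X"
      using \<delta>(2) gs by (metis ComplD subsetD vimageD)
    then show ?thesis
      using closure_subset by blast
  qed
  moreover have "e > 0"
    using \<delta>(1) by (simp add: e_def)
  ultimately show ?thesis by blast
qed

text \<open>The coefficient vectors admissible for one point form a closed set; finite separation
  gives the finite intersection property on a compact subset of the sphere.\<close>

lemma cube_separation:
  fixes X :: "(strop ^ 'd) set"
  assumes X: "TO_convex X" "X \<noteq> {}" and disj: "cube z e \<inter> X = {}"
  shows "\<exists>a. a \<noteq> 0 \<and> (\<forall>v\<in>X. \<not> neg_dominated UNIV (\<lambda>i. a $ i * homvec 1 v $ i)) \<and>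
    (\<forall>y\<in>cube z e. \<not> neg_dominated UNIV (\<lambda>i. - (a $ i * homvec 1 y $ i)))"
proof -
  define F where "F v = {a :: real ^ 'd option. \<not> neg_dominated UNIV (\<lambda>i. a $ i * homvec 1 v $ i)}" for v
  define G where "G = (\<Inter>y\<in>cube z e. {a :: real ^ 'd option. \<not> neg_dominated UNIV (\<lambda>i. - (a $ i * homvec 1 y $ i))})"
  have closed_F: "closed (F v)" for v
    unfolding F_def by (intro closed_Collect_neg open_neg_dominated) (auto intro!: continuous_intros)
  have "closed G"
    unfolding G_def
    by (intro closed_INT ballI closed_Collect_neg open_neg_dominated) (auto intro!: continuous_intros)
  have "(sphere 0 1 \<inter> G) \<inter> (\<Inter>v\<in>X. F v) \<noteq> {}"
  proof (rule compact_imp_fip_image)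
    show "compact (sphere 0 1 \<inter> G)"
      using \<open>closed G\<close> by (intro compact_Int_closed) auto
    fix T assume T: "finite T" "T \<subseteq> X"
    \<comment> \<open>\<open>T\<close> may be empty, while finite separation needs a nonempty
      set.\<close>
    obtain x where x: "x \<in> X"
      using X(2) by blast
    have "conv_TO (insert x T) \<inter> cube z e = {}"
      using X(1) T x disj unfolding TO_convex_def by (meson disjoint_iff finite.insertI insert_subset subsetD)
    then obtain a where "a \<in> sphere 0 1"
        "\<forall>v\<in>insert x T. \<not> neg_dominated UNIV (\<lambda>i. a $ i * homvec 1 v $ i)"
        "\<forall>y\<in>cube z e. \<not> neg_dominated UNIV (\<lambda>i. - (a $ i * homvec 1 y $ i))"
      using finite_separation[of "insert x T" z e] T by auto
    then show "(sphere 0 1 \<inter> G) \<inter> (\<Inter>v\<in>T. F v) \<noteq> {}"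
      unfolding F_def G_def by blast
  qed (rule closed_F)
  then obtain a where "a \<in> sphere 0 1" "a \<in> G" "\<forall>v\<in>X. a \<in> F v"
    by blast
  then show ?thesis
    unfolding F_def G_def by (intro exI[of _ a]) auto
qed

text \<open>Moving every coordinate of the centre in the direction of the sign of its coefficient
  increases all terms that are nonzero, except the constant one. If the value at the centre were
  not negative, the value at the moved point could then not be nonpositive.\<close>

lemma neg_dominated_centre:
  fixes z :: "strop ^ 'd"
  assumes "a \<noteq> 0" "e > 0"
    and y: "\<And>y. y \<in> cube z e \<Longrightarrow> \<not> neg_dominated UNIV (\<lambda>i. - (a $ i * homvec 1 y $ i))"
  shows "neg_dominated UNIV (\<lambda>i. a $ i * homvec 1 z $ i)"
proof (rule ccontr)
  define y where "y = (\<chi> j. slog (sexp (z $ j) + e * sgn (a $ Some j)))"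
  define u where "u i = a $ i * homvec 1 z $ i" for i
  define w where "w i = a $ i * homvec 1 y $ i" for i
  assume "\<not> neg_dominated UNIV (\<lambda>i. a $ i * homvec 1 z $ i)"
  then have u: "\<exists>i. 0 \<le> u i + u j" for j
    by (auto simp: neg_dominated_def u_def not_less)
  have "y \<in> cube z e"
    using \<open>e > 0\<close> by (auto simp: cube_def y_def abs_mult sgn_real_def)
  then have w: "\<exists>i. w i + w j \<le> 0" for j
  proof -
    have "\<not> neg_dominated UNIV (\<lambda>i. - w i)"
      using assms(3)[OF \<open>y \<in> cube z e\<close>] unfolding w_def .
    then obtain i where "\<not> - w i + - w j < 0"
      unfolding neg_dominated_def by blast
    then show ?thesis
      by (intro exI[of _ i]) linarith
  qed
  have at_None: "u None = a $ None" "w None = a $ None"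
    by (simp_all add: u_def w_def)
  have "a $ Some j * sgn (a $ Some j) = \<bar>a $ Some j\<bar>" for j
    by (simp add: mult_sgn_abs abs_sgn)
  then have at_Some: "w (Some j) = u (Some j) + e * \<bar>a $ Some j\<bar>" for j
    by (simp add: u_def w_def y_def algebra_simps)
  have le: "u i \<le> w i" for i
    using \<open>e > 0\<close> by (cases i) (simp_all add: at_None at_Some)
  have eq: "i = None \<or> u i = 0" if "w i \<le> u i" for i
  proof (cases i)
    case (Some j)
    then have "e * \<bar>a $ Some j\<bar> \<le> 0"
      using that at_Some[of j] Some by simp
    then have "a $ Some j = 0"
      using \<open>e > 0\<close> by (simp add: mult_le_0_iff)
    then show ?thesis
      by (simp add: u_def Some)
  qed simp
  obtain j where j: "w i \<le> w j" for i
  proof -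
    have "Max (range w) \<in> range w"
      by (rule Max_in) auto
    then obtain j where "Max (range w) = w j" by blast
    then show thesis
      using that[of j] by (metis Max_ge finite finite_imageI rangeI)
  qed
  \<comment> \<open>The chain
    \<open>0 \<le> u k + u i0 \<le> w k + w i0 \<le> w j + w i0 \<le> 0\<close> collapses to
    equalities.\<close>
  obtain i0 where i0: "w i0 + w j \<le> 0" using w by blast
  obtain k where k: "0 \<le> u k + u i0" using u by blast
  have "w k \<le> u k" "w i0 \<le> u i0" "w j = u k" "u i0 = - u k"
    using i0 k le[of i0] le[of k] j[of k] by linarith+
  then have "w j = 0"
    using eq[of k] eq[of i0] by auto
  \<comment> \<open>As the maximum \<open>w j\<close> is 0, every \<open>u k'\<close> is
    nonpositive, so a nonnegative \<open>u k' + u i\<close> forces \<open>u i\<close> to be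
    nonnegative.\<close>
  have pos: "0 \<le> u i" for i
  proof -
    obtain k' where "0 \<le> u k' + u i" using u by blast
    then show ?thesis
      using le[of k'] j[of k'] \<open>w j = 0\<close> by linarith
  qed
  have "u i = 0" "w i = 0" for i
    using pos[of i] le[of i] j[of i] \<open>w j = 0\<close> by linarith+
  then have "a $ i = 0" for i
    using at_None at_Some \<open>e > 0\<close> by (cases i) auto
  then show False
    using \<open>a \<noteq> 0\<close> by (simp add: vec_eq_iff)
qed

lemma halfspace_separation:
  fixes X :: "(strop ^ 'd) set"
  assumes X: "TO_convex X" and z: "z \<notin> closure X"
  shows "\<exists>a0 a. a \<noteq> 0 \<and> X \<subseteq> halfspace a0 a \<and> z \<notin> halfspace a0 a"
proof (cases "X = {}")
  case True
  \<comment> \<open>For empty \<open>X\<close> any halfspace missing \<open>z\<close> will do: here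
    the negative constant outweighs the only other nonconstant term, that of coordinate
    \<open>j\<close>.\<close>
  fix j :: 'd
  define a0 where "a0 = slog (- \<bar>sexp (z $ j)\<bar> - 1)"
  define a :: "strop ^ 'd" where "a = (\<chi> i. if i = j then 1 else 0)"
  have "homvec a0 a $ i * homvec 1 z $ i + homvec a0 a $ None * homvec 1 z $ None < 0" for i
    by (cases i) (auto simp: a0_def a_def)
  then have "z \<notin> halfspace a0 a"
    unfolding in_halfspace_iff neg_dominated_def by blast
  moreover have "(1 :: strop) \<noteq> 0"
    by (metis sexp_0 sexp_1 zero_neq_one)
  then have "a \<noteq> 0"
    by (auto simp: a_def vec_eq_iff)
  ultimately show ?thesis
    using True by blast
next
  case False
  obtain e where e: "e > 0" "cube z e \<inter> X = {}"
    using exists_cube_disjoint[OF z] by blast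
  obtain b where b: "b \<noteq> 0" "\<forall>v\<in>X. \<not> neg_dominated UNIV (\<lambda>i. b $ i * homvec 1 v $ i)"
    "\<forall>y\<in>cube z e. \<not> neg_dominated UNIV (\<lambda>i. - (b $ i * homvec 1 y $ i))"
    using cube_separation[OF X False e(2)] by blast
  obtain a0 a where a: "homvec a0 a = b"
    using ex_homvec by blast
  have "z \<notin> halfspace a0 a"
    using neg_dominated_centre[OF b(1) e(1)] b(3) by (simp add: in_halfspace_iff a)
  moreover have "X \<subseteq> halfspace a0 a"
    using b(2) by (auto simp: in_halfspace_iff a)
  \<comment> \<open>With \<open>a = 0\<close> the halfspace would be everything or empty, but it
    contains the nonempty \<open>X\<close> and misses \<open>z\<close>.\<close>
  moreover have "a \<noteq> 0"
  proof
    assume "a = 0"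
    then have "x \<in> halfspace a0 a \<longleftrightarrow> to_sym a0 \<in> tpos \<union> tbal" for x
      by (simp add: halfspace_def zero_strop.rep_eq)
    then show False
      using calculation False by blast
  qed
  ultimately show ?thesis by blast
qed

section \<open>Cones and linear halfspaces\<close>

lemma tcone_scale:
  assumes "tcone X" "x \<in> X" "t > 0"
  shows "slog t *s x \<in> X"
proof -
  have "to_sym (slog t) \<in> tpos"
    using assms(3) by (simp add: to_sym_in_tpos_iff)
  with assms(1) have "(\<lambda>x. slog t *s x) ` X \<subseteq> X"
    unfolding tcone_def by blast
  then show ?thesis using assms(2) by (rule subsetD[OF _ imageI])
qed

text \<open>If the linear part were negative at \<open>x\<close>, a large multiple of
  \<open>x\<close> would make its dominating term outweigh \<open>a0\<close> as well.\<close>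

lemma cone_subset_linear_halfspace:
  assumes "tcone X" "X \<subseteq> halfspace a0 a"
  shows "X \<subseteq> halfspace 0 a"
proof
  fix x assume x: "x \<in> X"
  show "x \<in> halfspace 0 a"
  proof (rule ccontr)
    define w where "w i = homvec 0 a $ i * homvec 1 x $ i" for i
    assume "x \<notin> halfspace 0 a"
    then obtain k where k: "\<And>i. w i + w k < 0"
      unfolding in_halfspace_iff neg_dominated_def w_def by blast
    have "w None = 0"
      by (simp add: w_def)
    then obtain j where j: "k = Some j" and neg: "w k < 0"
      using k[of k] by (cases k) auto
    define t where "t = (\<bar>sexp a0\<bar> + 1) / - w k"
    have t: "t > 0" "t * w k = - \<bar>sexp a0\<bar> - 1"
      using neg by (auto simp: t_def field_simps)
    have "homvec a0 a $ i * homvec 1 (slog t *s x) $ i +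
        homvec a0 a $ k * homvec 1 (slog t *s x) $ k < 0" for i
    proof (cases i)
      case None
      have "sexp a0 + t * w k < 0"
        using t by simp
      then show ?thesis
        by (simp add: None j w_def sexp_mult mult.left_commute)
    next
      case (Some i')
      have "t * (w i + w k) < 0"
        using k[of i] t by (simp add: mult_less_0_iff)
      then show ?thesis
        by (simp add: Some j w_def sexp_mult algebra_simps)
    qed
    then have "slog t *s x \<notin> halfspace a0 a"
      unfolding in_halfspace_iff neg_dominated_def by blast
    moreover have "slog t *s x \<in> X"
      using tcone_scale[OF assms(1) x] t by blast
    ultimately show False
      using assms(2) by blast
  qed
qed

text \<open>Shrinking a point of the cone makes every linear term smaller than the absolute value of
  a negative \<open>a0\<close>, which would then dominate.\<close>

lemma cone_subset_halfspace_constant: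
  assumes "tcone X" "X \<noteq> {}" "X \<subseteq> halfspace a0 a"
  shows "0 \<le> sexp a0"
proof (rule ccontr)
  assume neg: "\<not> 0 \<le> sexp a0"
  obtain x where x: "x \<in> X"
    using assms(2) by blast
  define w where "w i = homvec a0 a $ i * homvec 1 x $ i" for i
  define s where "s = (\<Sum>i\<in>UNIV. \<bar>w i\<bar>)"
  have s: "0 \<le> s" "w i \<le> s" for i
    using member_le_sum[of i UNIV "\<lambda>i. \<bar>w i\<bar>"] by (auto simp: s_def sum_nonneg)
  define t where "t = - sexp a0 / (s + 1)"
  have t: "t > 0" "t * s < - sexp a0"
    using neg s(1) by (auto simp: t_def field_simps)
  have "homvec a0 a $ i * homvec 1 (slog t *s x) $ i +
      homvec a0 a $ None * homvec 1 (slog t *s x) $ None < 0" for i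
  proof (cases i)
    case (Some j)
    have "t * w i < - sexp a0"
      using mult_left_mono[OF s(2)[of i], of t] t by linarith
    then show ?thesis
      by (simp add: Some w_def sexp_mult algebra_simps)
  qed (use neg in simp)
  then have "slog t *s x \<notin> halfspace a0 a"
    unfolding in_halfspace_iff neg_dominated_def by blast
  moreover have "slog t *s x \<in> X"
    using tcone_scale[OF assms(1) x] t by blast
  ultimately show False
    using assms(3) by blast
qed

text \<open>A nonnegative constant cannot be the dominating negative term, so the same index still
  dominates once the constant is replaced by 0.\<close>

lemma linear_halfspace_subset:
  assumes "0 \<le> sexp a0"
  shows "halfspace 0 a \<subseteq> halfspace a0 a"
proof (rule subsetI, rule ccontr)
  fix z assume z: "z \<in> halfspace 0 a" "z \<notin> halfspace a0 a"
  then obtain k where k: "\<And>i. homvec a0 a $ i * homvec 1 z $ i + homvec a0 a $ k * homvec 1 z $ k < 0"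
    unfolding in_halfspace_iff neg_dominated_def by blast
  then obtain j where j: "k = Some j"
    using assms k[of None] k[of k] by (cases k) auto
  have "homvec 0 a $ i * homvec 1 z $ i + homvec 0 a $ k * homvec 1 z $ k < 0" for i
    using k[of i] k[of None] assms by (cases i) (simp_all add: j)
  then show False
    using z(1) unfolding in_halfspace_iff neg_dominated_def by blast
qed

theorem corollary6p2:
  fixes X :: "(strop ^ 'd) set"
  assumes "TO_convex X"
  shows "closure X = \<Inter> {H \<in> closed_halfspaces. X \<subseteq> H} \<and>
    (X \<noteq> {} \<and> tcone X \<longrightarrow> closure X = \<Inter> {H \<in> linear_closed_halfspaces. X \<subseteq> H})"
proof (intro conjI impI equalityI Inter_greatest subsetI)
  fix H z
  assume "H \<in> {H \<in> closed_halfspaces. X \<subseteq> H}" "z \<in> closure X"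
  then show "z \<in> H"
    using closure_minimal[of X H] closed_halfspace by (auto simp: closed_halfspaces_def)
next
  fix H z
  assume "H \<in> {H \<in> linear_closed_halfspaces. X \<subseteq> H}" "z \<in> closure X"
  then show "z \<in> H"
    using closure_minimal[of X H] closed_halfspace by (auto simp: linear_closed_halfspaces_def)
next
  fix z
  assume z: "z \<in> \<Inter> {H \<in> closed_halfspaces. X \<subseteq> H}"
  show "z \<in> closure X"
  proof (rule ccontr)
    assume "z \<notin> closure X"
    then obtain a0 a where "a \<noteq> 0" "X \<subseteq> halfspace a0 a" "z \<notin> halfspace a0 a"
      using halfspace_separation[OF assms] by blast
    moreover from this have "halfspace a0 a \<in> {H \<in> closed_halfspaces. X \<subseteq> H}"
      by (auto simp: closed_halfspaces_def)
    ultimately show False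
      using z by (meson InterD)
  qed
next
  fix z
  assume X: "X \<noteq> {} \<and> tcone X" and z: "z \<in> \<Inter> {H \<in> linear_closed_halfspaces. X \<subseteq> H}"
  show "z \<in> closure X"
  proof (rule ccontr)
    assume "z \<notin> closure X"
    then obtain a0 a where a: "a \<noteq> 0" "X \<subseteq> halfspace a0 a" "z \<notin> halfspace a0 a"
      using halfspace_separation[OF assms] by blast
    \<comment> \<open>Dropping the constant keeps the cone inside; since the constant is
      nonnegative, \<open>z\<close> stays outside.\<close>
    have "X \<subseteq> halfspace 0 a"
      using X a(2) by (auto intro: cone_subset_linear_halfspace[THEN subsetD])
    then have "halfspace 0 a \<in> {H \<in> linear_closed_halfspaces. X \<subseteq> H}"
      using a(1) by (auto simp: linear_closed_halfspaces_def)
    then have "z \<in> halfspace 0 a"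
      using z by (meson InterD)
    then show False
      using X a linear_halfspace_subset[OF cone_subset_halfspace_constant, of X a0 a] by blast
  qed
qed

end
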